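(* Let $G$ be a graph. Then \[M(G)-Z_{\mathrm{vc}}(G)\leq \xi(G).\]
   Context: Graphs are finite, simple and undirected; $\overline{G}$ is the complement of $G$, and a non-edge of $G$ is an edge of $\overline{G}$. $N_G(i)$ is the neighborhood of $i$ and $N_G[i]=N_G(i)\cup\{i\}$. Matrices. $\mathcal{S}(G)$ is the set of real symmetric matrices indexed by $V(G)$ whose $i,j$-entry, $i\neq j$, is nonzero if $i$ and $j$ are adjacent in $G$ and zero otherwise (diagonal entries are arbitrary real numbers). A symmetric matrix $A$ has the Strong Arnold Property (SAP) if $X=O$ is the only real symmetric matrix with $A\circ X=O$, $I\circ X=O$ and $AX=O$, where $\circ$ is the entrywise product. With $\mathrm{null}(A)$ the nullity of $A$, $M(G)=\max\{\mathrm{null}(A):A\in\mathcal{S}(G)\}$ and $\xi(G)=\max\{\mathrm{null}(A):A\in\mathcal{S}(G),\ A\text{ has the SAP}\}$. SAP color change rule. At every stage each non-edge of $G$ is blue or white. Let $B_E$ be the current set of blue non-edges. For a vertex $k$, let $N_{B_E}(k)=\{j:\{j,k\}\in B_E\}$. The local game at $k$ is the zero forcing game on $G$ in which the blue vertices are $\phi_k(G,B_E)=N_G[k]\cup N_{B_E}(k)$ and all other vertices are white; $i\rightarrow j$ in the local game at $k$ means that $i$ is blue, and $j$ is the only white neighbor of $i$ in $G$. The color change rule CCR-$Z_{\mathrm{SAP}}$ consists of: (1) (forcing triple) if $\{j,k\}$ is a white non-edge and $i\rightarrow j$ in the local game at $k$ for some vertex $i$, then $\{j,k\}$ turns blue;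 this is denoted $(k:i\rightarrow j)$; (2) (odd cycle rule) let $\overline{G}_W$ be the graph on $V(G)$ whose edges are the white non-edges; if for some vertex $i$ the induced subgraph $\overline{G}_W[N_G(i)]$ has a connected component that is an odd cycle $C$, then all non-edges on $C$ turn blue. The parameter $Z_{\mathrm{vc}}$. For $B\subseteq V(G)$ let $\overline{cl}(B)$ be the set of all non-edges of $G$ incident to at least one vertex of $B$. $Z_{\mathrm{vc}}(G)$ is the minimum cardinality of a set $B\subseteq V(G)$ such that, starting with exactly the non-edges in $\overline{cl}(B)$ blue, every non-edge becomes blue by repeated applications of CCR-$Z_{\mathrm{SAP}}$ with the restriction that $(k:i\rightarrow j)$ may not be used to perform a force if $i\in B$ and $\{i,k\}\in E(\overline{G})$. *)

theory Defs
  imports "HOL-Analysis.Analysis"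
begin

text \<open>
  The vertex set of a graph is a finite type \<open>'v\<close>; a graph is given by its set of edges, each
  edge being a two-element set of vertices.
\<close>

type_synonym 'v edges = "'v set set"

definition simple_graph :: "'v edges \<Rightarrow> bool" where
  "simple_graph G \<longleftrightarrow> (\<forall>e\<in>G. card e = 2)"

definition complement :: "'v edges \<Rightarrow> 'v edges" where
  "complement G = {e. card e = 2 \<and> e \<notin> G}"

definition nbhd :: "'v edges \<Rightarrow> 'v \<Rightarrow> 'v set" where
  "nbhd G i = {j. {i, j} \<in> G}"

definition closed_nbhd :: "'v edges \<Rightarrow> 'v \<Rightarrow> 'v set" where
  "closed_nbhd G i = insert i (nbhd G i)"

definition induced_edges :: "'v edges \<Rightarrow> 'v set \<Rightarrow> 'v edges" where
  "induced_edges G U = {e \<in> G. e \<subseteq> U}"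

text \<open>Vertex sets of the connected components of the graph with vertex set \<open>U\<close> and edge set
  \<open>F\<close>, where the edges in \<open>F\<close> are assumed to lie inside \<open>U\<close>.\<close>

definition graph_components :: "'v set \<Rightarrow> 'v edges \<Rightarrow> 'v set set" where
  "graph_components U F = U // {(x, y). {x, y} \<in> F}\<^sup>*"

text \<open>The graph with vertex set \<open>C\<close> and edge set \<open>F\<close> is a cycle (as a graph, so
  without chords).\<close>

definition cycle_graph :: "'v set \<Rightarrow> 'v edges \<Rightarrow> bool" where
  "cycle_graph C F \<longleftrightarrow>
     (\<exists>vs. distinct vs \<and> length vs \<ge> 3 \<and> set vs = C \<and>
        F = {{vs ! n, vs ! (Suc n mod length vs)} | n. n < length vs})"


subsection \<open>Matrices of a graph\<close>

definition graph_matrices :: "'v::finite edges \<Rightarrow> (real ^ 'v ^ 'v) set" where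
  "graph_matrices G =
     {A. transpose A = A \<and> (\<forall>i j. i \<noteq> j \<longrightarrow> (A $ i $ j \<noteq> 0 \<longleftrightarrow> {i, j} \<in> G))}"

definition nullity :: "real ^ 'n ^ 'm \<Rightarrow> nat" where
  "nullity A = dim {x. A *v x = 0}"

text \<open>In the following definition \<open>*\<close> is the entrywise product (the library's multiplication on
  type \<^typ>\<open>real ^ 'v ^ 'v\<close>), while \<open>**\<close> is the matrix product.\<close>

definition SAP :: "real ^ 'v ^ 'v \<Rightarrow> bool" where
  "SAP A \<longleftrightarrow>
     (\<forall>X :: real ^ 'v ^ 'v.
        transpose X = X \<and> A * X = 0 \<and> mat 1 * X = 0 \<and> A ** X = 0 \<longrightarrow> X = 0)"

text \<open>Both maxima below are over nonempty sets of numbers bounded by the order of the graph;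
  see \<open>max_nullity_wf\<close> and \<open>xi_wf\<close>.\<close>

definition max_nullity :: "'v::finite edges \<Rightarrow> nat" where
  "max_nullity G = Max {nullity A | A. A \<in> graph_matrices G}"

definition xi :: "'v::finite edges \<Rightarrow> nat" where
  "xi G = Max {nullity A | A. A \<in> graph_matrices G \<and> SAP A}"


subsection \<open>The SAP color change rule\<close>

text \<open>Throughout, \<open>BE\<close> is the current set of blue non-edges.\<close>

definition local_blue :: "'v edges \<Rightarrow> 'v edges \<Rightarrow> 'v \<Rightarrow> 'v set" where
  "local_blue G BE k = closed_nbhd G k \<union> nbhd BE k"

definition zf_forces :: "'v edges \<Rightarrow> 'v set \<Rightarrow> 'v \<Rightarrow> 'v \<Rightarrow> bool" where
  "zf_forces G S i j \<longleftrightarrow> i \<in> S \<and> nbhd G i - S = {j}"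

definition white_nonedges :: "'v edges \<Rightarrow> 'v edges \<Rightarrow> 'v edges" where
  "white_nonedges G BE = complement G - BE"

definition forcing_triple :: "'v edges \<Rightarrow> 'v edges \<Rightarrow> 'v \<Rightarrow> 'v \<Rightarrow> 'v \<Rightarrow> bool" where
  "forcing_triple G BE k i j \<longleftrightarrow>
     {j, k} \<in> white_nonedges G BE \<and> zf_forces G (local_blue G BE k) i j"

definition white_odd_cycle :: "'v edges \<Rightarrow> 'v edges \<Rightarrow> 'v \<Rightarrow> 'v set \<Rightarrow> bool" where
  "white_odd_cycle G BE i C \<longleftrightarrow>
     C \<in> graph_components (nbhd G i) (induced_edges (white_nonedges G BE) (nbhd G i)) \<and>
     cycle_graph C (induced_edges (white_nonedges G BE) C) \<and> odd (card C)"

text \<open>One application of the color change rule, where forcing triples \<open>(k: i \<rightarrow> j)\<close> with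
  \<open>i \<in> B\<close> and \<open>{i, k}\<close> a non-edge are forbidden.\<close>

inductive vc_step :: "'v edges \<Rightarrow> 'v set \<Rightarrow> 'v edges \<Rightarrow> 'v edges \<Rightarrow> bool"
  for G :: "'v edges" and B :: "'v set" where
  triple: "forcing_triple G BE k i j \<Longrightarrow> \<not> (i \<in> B \<and> {i, k} \<in> complement G) \<Longrightarrow>
           vc_step G B BE (insert {j, k} BE)"
| odd_cycle: "white_odd_cycle G BE i C \<Longrightarrow>
           vc_step G B BE (BE \<union> induced_edges (white_nonedges G BE) C)"

definition nonedge_closure :: "'v edges \<Rightarrow> 'v set \<Rightarrow> 'v edges" where
  "nonedge_closure G B = {e \<in> complement G. e \<inter> B \<noteq> {}}"

definition vc_forcing_set :: "'v edges \<Rightarrow> 'v set \<Rightarrow> bool" where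
  "vc_forcing_set G B \<longleftrightarrow> (vc_step G B)\<^sup>*\<^sup>* (nonedge_closure G B) (complement G)"

definition Z_vc :: "'v::finite edges \<Rightarrow> nat" where
  "Z_vc G = Min {card B | B. vc_forcing_set G B}"


subsection \<open>The parameters are well-defined\<close>

lemma nullity_le: "nullity (A :: real ^ 'v ^ 'v) \<le> CARD('v::finite)"
  unfolding nullity_def using dim_subset_UNIV_cart by blast

lemma finite_nullities: "finite {nullity A | A :: real ^ 'v ^ 'v. P A}"
  by (rule finite_subset[of _ "{..CARD('v)}"]) (auto simp: nullity_le)

lemma exists_SAP_matrix: "\<exists>A \<in> graph_matrices (G :: 'v::finite edges). SAP A"
proof -
  define A :: "real ^ 'v ^ 'v" where
    "A = (\<chi> i j. if i = j then real CARD('v) + 1 else if {i, j} \<in> G then 1 else 0)"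
  have A: "A \<in> graph_matrices G"
    by (auto simp: graph_matrices_def A_def transpose_def vec_eq_iff insert_commute)
  have inj: "x = 0" if Ax: "A *v x = 0" for x
  proof -
    have "Max (range (\<lambda>j. \<bar>x $ j\<bar>)) \<in> range (\<lambda>j. \<bar>x $ j\<bar>)"
      by (rule Max_in) auto
    then obtain i where i': "\<bar>x $ i\<bar> = Max (range (\<lambda>j. \<bar>x $ j\<bar>))"
      by (metis rangeE)
    have i: "\<bar>x $ j\<bar> \<le> \<bar>x $ i\<bar>" for j
      unfolding i' by (rule Max_ge) auto
    have "0 = (\<Sum>j\<in>UNIV. A $ i $ j * x $ j)"
      using Ax by (simp add: vec_eq_iff matrix_vector_mult_def)
    also have "\<dots> = A $ i $ i * x $ i + (\<Sum>j\<in>UNIV - {i}. A $ i $ j * x $ j)"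
      by (rule sum.remove) auto
    finally have "\<bar>A $ i $ i * x $ i\<bar> = \<bar>\<Sum>j\<in>UNIV - {i}. A $ i $ j * x $ j\<bar>"
      by linarith
    also have "\<dots> \<le> (\<Sum>j\<in>UNIV - {i}. \<bar>A $ i $ j * x $ j\<bar>)"
      by (rule sum_abs)
    also have "\<dots> \<le> (\<Sum>j\<in>UNIV - {i}. \<bar>x $ i\<bar>)"
      by (rule sum_mono) (use i in \<open>auto simp: A_def\<close>)
    also have "\<dots> \<le> (\<Sum>j\<in>(UNIV :: 'v set). \<bar>x $ i\<bar>)"
      by (rule sum_mono2) auto
    finally have "(real CARD('v) + 1) * \<bar>x $ i\<bar> \<le> real CARD('v) * \<bar>x $ i\<bar>"
      by (simp add: A_def abs_mult)
    then have "\<bar>x $ i\<bar> = 0"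
      by (simp add: algebra_simps)
    with i have "x $ j = 0" for j
      by (metis abs_le_zero_iff)
    then show ?thesis by (simp add: vec_eq_iff)
  qed
  have "SAP A"
    unfolding SAP_def
  proof (intro allI impI)
    fix X :: "real ^ 'v ^ 'v"
    assume "transpose X = X \<and> A * X = 0 \<and> mat 1 * X = 0 \<and> A ** X = 0"
    then have "A *v column j X = 0" for j
      by (simp add: vec_eq_iff matrix_vector_mult_def matrix_matrix_mult_def column_def)
    then have "column j X = 0" for j using inj by blast
    then show "X = 0" by (simp add: vec_eq_iff column_def)
  qed
  with A show ?thesis by blast
qed

lemma max_nullity_wf:
  "finite {nullity A | A. A \<in> graph_matrices G}" "{nullity A | A. A \<in> graph_matrices G} \<noteq> {}"
proof -
  show "finite {nullity A | A. A \<in> graph_matrices G}" by (rule finite_nullities)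
  show "{nullity A | A. A \<in> graph_matrices G} \<noteq> {}" using exists_SAP_matrix[of G] by blast
qed

lemma xi_wf:
  "finite {nullity A | A. A \<in> graph_matrices G \<and> SAP A}"
  "{nullity A | A. A \<in> graph_matrices G \<and> SAP A} \<noteq> {}"
proof -
  show "finite {nullity A | A. A \<in> graph_matrices G \<and> SAP A}" by (rule finite_nullities)
  show "{nullity A | A. A \<in> graph_matrices G \<and> SAP A} \<noteq> {}" using exists_SAP_matrix[of G] by blast
qed

lemma Z_vc_wf:
  "finite {card B | B :: 'v::finite set. vc_forcing_set G B}"
  "{card B | B :: 'v::finite set. vc_forcing_set G B} \<noteq> {}"
proof -
  have "nonedge_closure G UNIV = complement G"
    by (auto simp: nonedge_closure_def complement_def)
  then have "vc_forcing_set G UNIV" by (simp add: vc_forcing_set_def)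
  then show "{card B | B :: 'v::finite set. vc_forcing_set G B} \<noteq> {}" by blast
qed simp

end

(*
  Let A attain M(G), let B be a minimum forcing set, and let I_B be the diagonal indicator matrix
  of B.  For all but finitely many real t, every vector in the kernel of A + t I_B vanishes on B:
  if x and y are kernel vectors for distinct parameters s and t, then computing y^T A x in two ways
  gives s <x_B, y_B> = t <x_B, y_B>, so the nonzero restrictions to B belonging to different
  parameters are pairwise orthogonal, hence finite in number.  Fix such a t.  The kernel of
  A' = A + t I_B contains {x in ker A. x_B = 0}, whose dimension is at least M(G) - |B|.  If X is a
  matrix as in the definition of the SAP for A', its columns lie in ker A', so X vanishes on all
  non-edges meeting B; each application of the color change rule then yields further zero entries
  of X, until X = 0.
*)
theory Submission
  imports Defs
begin

section \<open>Kernels of diagonal shifts and of coordinate restrictions\<close>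

lemma inner_symmetric_matrix:
  fixes A :: "real ^ 'v ^ 'v::finite"
  assumes "transpose A = A"
  shows "(A *v x) \<bullet> y = x \<bullet> (A *v y)"
  using assms by (metis dot_lmul_matrix transpose_matrix_vector)

lemma diagonal_shift_kernel_vanishes:
  fixes A :: "real ^ 'v ^ 'v::finite" and B :: "'v set"
  assumes sym: "transpose A = A"
  obtains t where "\<And>x b.
    A *v x + t *\<^sub>R (\<chi> i. if i \<in> B then x $ i else 0) = 0 \<Longrightarrow> b \<in> B \<Longrightarrow> x $ b = 0"
proof -
  define r :: "real ^ 'v \<Rightarrow> real ^ 'v" where "r x = (\<chi> i. if i \<in> B then x $ i else 0)" for x
  \<comment> \<open>The map \<open>r\<close> is an orthogonal projection, so it may be moved freely
    between the two factors of an inner product.\<close>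
  have r_inner: "r x \<bullet> y = r x \<bullet> r y" "x \<bullet> r y = r x \<bullet> r y" for x y
    by (auto simp: r_def inner_vec_def intro!: sum.cong)
  have "\<exists>t. \<forall>x. A *v x + t *\<^sub>R r x = 0 \<longrightarrow> r x = 0"
  proof (rule ccontr)
    assume "\<nexists>t. \<forall>x. A *v x + t *\<^sub>R r x = 0 \<longrightarrow> r x = 0"
    then have "\<forall>t. \<exists>x. A *v x + t *\<^sub>R r x = 0 \<and> r x \<noteq> 0" by blast
    then obtain f where f: "\<And>t. A *v f t + t *\<^sub>R r (f t) = 0" "\<And>t. r (f t) \<noteq> 0"
      by metis
    have Af: "A *v f t = - (t *\<^sub>R r (f t))" for t
      using f(1)[of t] by (simp add: eq_neg_iff_add_eq_0)
    have orth: "r (f s) \<bullet> r (f t) = 0" if "s \<noteq> t" for s t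
    proof -
      have "(A *v f s) \<bullet> f t = f s \<bullet> (A *v f t)"
        by (rule inner_symmetric_matrix[OF sym])
      then have "s * (r (f s) \<bullet> r (f t)) = t * (r (f s) \<bullet> r (f t))"
        unfolding Af by (simp add: r_inner[of "f s" "f t"])
      with that show ?thesis by simp
    qed
    \<comment> \<open>One bad vector was chosen for every real \<open>t\<close>. Nonzero orthogonal
      vectors are distinct, and a pairwise orthogonal set is finite, so there would be only finitely
      many reals.\<close>
    have "inj (\<lambda>t. r (f t))"
      by (rule injI) (metis f(2) inner_eq_zero_iff orth)
    moreover have "finite (range (\<lambda>t. r (f t)))"
      by (rule pairwise_orthogonal_imp_finite)
        (auto simp: pairwise_def orthogonal_def intro!: orth)
    ultimately show False
      using finite_imageD infinite_UNIV_char_0 by blast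
  qed
  then obtain t where t: "\<And>x. A *v x + t *\<^sub>R r x = 0 \<Longrightarrow> r x = 0" by blast
  have "x $ b = 0" if "A *v x + t *\<^sub>R r x = 0" "b \<in> B" for x b
    using arg_cong[OF t[OF that(1)], of "\<lambda>y. y $ b"] that(2) by (simp add: r_def)
  then show thesis using that unfolding r_def by blast
qed

text \<open>The coordinate subspace \<open>T\<close> has codimension \<open>card B\<close>, and
  intersecting with it lowers a dimension by at most its codimension.\<close>

lemma dim_Int_vanishing_ge:
  fixes S :: "(real ^ 'v::finite) set" and B :: "'v set"
  assumes "subspace S"
  shows "dim S \<le> dim (S \<inter> {x. \<forall>b\<in>B. x $ b = 0}) + card B"
proof -
  define T :: "(real ^ 'v) set" where "T = {x. \<forall>b\<in>B. x $ b = 0}"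
  have "T = {x. \<forall>i. i \<notin> - B \<longrightarrow> x $ i = 0}" by (auto simp: T_def)
  then have "dim T = card (- B)" 
    using dim_substandard_cart[where 'a = real and d = "- B"] by (simp only: dim_vec_eq)
  then have dT: "dim T + card B = CARD('v)"
    using card_Un_disjoint[of "- B" B] by (simp add: Compl_partition2)
  have "subspace T" by (auto simp: T_def subspace_def)
  from dim_sums_Int[OF assms this]
  have "dim {x + y |x y. x \<in> S \<and> y \<in> T} + dim (S \<inter> T) = dim S + dim T" .
  moreover have "dim {x + y |x y. x \<in> S \<and> y \<in> T} \<le> CARD('v)"
    by (rule dim_subset_UNIV_cart)
  ultimately show ?thesis using dT unfolding T_def by linarith
qed

section \<open>Arithmetic on cyclic indices\<close>

lemma alternating_odd_cycle_zero:
  fixes z :: "nat \<Rightarrow> real"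
  assumes "odd m" and alt: "\<And>n. n < m \<Longrightarrow> z n + z (Suc n mod m) = 0" and "n < m"
  shows "z n = 0"
proof -
  have z: "z n = (-1) ^ n * z 0" if "n < m" for n
    using that
  proof (induction n)
    case (Suc n)
    then show ?case using alt[of n] by simp
  qed simp
  \<comment> \<open>The last index \<open>p\<close> is even, so the relation that closes the cycle
    reads \<open>2 * z 0 = 0\<close>.\<close>
  obtain p where m: "m = Suc p" using assms(1) by (cases m) auto
  then have "z p + z 0 = 0" using alt[of p] by simp
  moreover have "z p = z 0" using z[of p] m assms(1) by simp
  ultimately have "z 0 = 0" by simp
  with z[OF assms(3)] show ?thesis by simp
qed

lemma mod_Suc_cancel:
  assumes "Suc p mod m = Suc n mod m" "p < m" "n < m"
  shows "p = n"
  using assms by (auto simp: mod_Suc split: if_splits)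

section \<open>Zero entries of \<open>X\<close> under the color change rule\<close>

locale SAP_kernel =
  fixes G :: "'v::finite edges" and A X :: "real ^ 'v ^ 'v"
  assumes simple: "simple_graph G"
    and A: "A \<in> graph_matrices G"
    and X_sym: "X $ j $ k = X $ k $ j"
    and X_diag: "X $ k $ k = 0"
    and X_edge: "{j, k} \<in> G \<Longrightarrow> X $ j $ k = 0"
    and AX: "(\<Sum>l\<in>UNIV. A $ i $ l * X $ l $ k) = 0"
begin

lemma A_nonzero_iff: "i \<noteq> j \<Longrightarrow> A $ i $ j \<noteq> 0 \<longleftrightarrow> {i, j} \<in> G"
  using A by (simp add: graph_matrices_def)

lemma nbhd_neq: "j \<in> nbhd G i \<Longrightarrow> i \<noteq> j"
  using simple by (auto simp: nbhd_def simple_graph_def)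

text \<open>In the entry \<open>(i, k)\<close> of \<open>A ** X\<close>, blue vertices
  \<open>l\<close> have \<open>X $ l $ k = 0\<close> and non-neighbors of \<open>i\<close> other
  than \<open>i\<close> have \<open>A $ i $ l = 0\<close>. Only the term of \<open>j\<close>
  survives, and its factor \<open>A $ i $ j\<close> is nonzero.\<close>

lemma forcing_triple_zero:
  assumes blue: "\<And>j k. {j, k} \<in> BE \<Longrightarrow> X $ j $ k = 0"
    and force: "forcing_triple G BE k i j"
  shows "X $ j $ k = 0"
proof -
  define S where "S = local_blue G BE k"
  have i: "i \<in> S" and nb: "nbhd G i - S = {j}"
    using force by (auto simp: forcing_triple_def zf_forces_def S_def)
  have S_zero: "X $ l $ k = 0" if "l \<in> S" for l
    using that X_sym X_diag X_edge blue
    by (auto simp: S_def local_blue_def closed_nbhd_def nbhd_def insert_commute)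
  have "(\<Sum>l\<in>UNIV. A $ i $ l * X $ l $ k) = (\<Sum>l\<in>{j}. A $ i $ l * X $ l $ k)"
  proof (rule sum.mono_neutral_right)
    show "\<forall>l\<in>UNIV - {j}. A $ i $ l * X $ l $ k = 0"
    proof
      fix l assume "l \<in> UNIV - {j}"
      then have "l \<in> S \<or> l \<notin> nbhd G i" using nb by blast
      \<comment> \<open>The diagonal entry \<open>A $ i $ i\<close> is arbitrary; for
        \<open>l = i\<close> the term vanishes because \<open>i\<close> is blue.\<close>
      then show "A $ i $ l * X $ l $ k = 0"
        using S_zero i A_nonzero_iff[of i l] by (cases "l = i") (auto simp: nbhd_def)
    qed
  qed auto
  then have "A $ i $ j * X $ j $ k = 0" using AX by simp
  moreover have "j \<in> nbhd G i" using nb by blast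
  then have "A $ i $ j \<noteq> 0" using A_nonzero_iff[of i j] nbhd_neq by (auto simp: nbhd_def)
  ultimately show ?thesis by simp
qed

text \<open>For a vertex \<open>v\<close> of the cycle, the entry \<open>(i, v)\<close> of
  \<open>A ** X\<close> reduces to the terms of the two cycle neighbors of \<open>v\<close>. This
  gives one two-term relation per cycle vertex.\<close>

lemma white_odd_cycle_zero:
  assumes blue: "\<And>j k. {j, k} \<in> BE \<Longrightarrow> X $ j $ k = 0"
    and cyc: "white_odd_cycle G BE i C"
    and jk: "{j, k} \<in> induced_edges (white_nonedges G BE) C"
  shows "X $ j $ k = 0"
proof -
  define W where "W = white_nonedges G BE"
  define N where "N = nbhd G i"
  define R where "R = {(x, y). {x, y} \<in> induced_edges W N}"
  have comp: "C \<in> N // R\<^sup>*" and odd: "odd (card C)"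
    using cyc by (auto simp: white_odd_cycle_def graph_components_def W_def N_def R_def)
  obtain vs where vs: "distinct vs" "length vs \<ge> 3" "set vs = C"
    and edges: "induced_edges W C = {{vs ! n, vs ! (Suc n mod length vs)} | n. n < length vs}"
    using cyc by (auto simp: white_odd_cycle_def cycle_graph_def W_def)
  define m where "m = length vs"
  have m: "m \<ge> 3" "odd m" using vs odd by (auto simp: m_def distinct_card[symmetric])
  have inC: "vs ! n \<in> C" if "n < m" for n
    using that vs by (auto simp: m_def)
  have vs_inj: "p = n" if "vs ! p = vs ! n" "p < m" "n < m" for p n
    using that vs nth_eq_iff_index_eq by (auto simp: m_def)
  obtain x where x: "x \<in> N" "C = R\<^sup>* `` {x}" using comp by (auto elim: quotientE)
  have "y \<in> N" if "(x, y) \<in> R\<^sup>*" for y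
    using that x(1) by (induction) (auto simp: R_def induced_edges_def)
  then have CN: "C \<subseteq> N" using x(2) by blast
  \<comment> \<open>A connected component absorbs every white edge inside \<open>N\<close> that
    starts in it.\<close>
  have C_closed: "l \<in> C" if "k \<in> C" "l \<in> N" "{k, l} \<in> W" for k l
    using that CN x(2) by (auto simp: R_def induced_edges_def intro: rtrancl_into_rtrancl)
  have A_C: "A $ i $ l \<noteq> 0" if "l \<in> C" for l
    using that CN nbhd_neq[of l i] A_nonzero_iff[of i l] by (auto simp: N_def nbhd_def)
  have row: "A $ i $ (vs ! n) * X $ (vs ! n) $ (vs ! n1)
      + A $ i $ (vs ! n2) * X $ (vs ! n2) $ (vs ! n1) = 0"
    if n: "n < m" and n1_def: "n1 = Suc n mod m" and n2_def: "n2 = Suc n1 mod m" for n n1 n2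
  proof -
    have lt: "n1 < m" "n2 < m" using m by (auto simp: n1_def n2_def)
    \<comment> \<open>A cycle of length at least 3 has two different neighbors \<open>n\<close> and
      \<open>n2\<close> around \<open>n1\<close>, so the sum below really has two terms.\<close>
    have "n \<noteq> n2" using n m by (auto simp: n1_def n2_def mod_Suc split: if_splits)
    then have ne: "vs ! n \<noteq> vs ! n2" using vs_inj n lt by blast
    have "(\<Sum>l\<in>UNIV. A $ i $ l * X $ l $ (vs ! n1))
        = (\<Sum>l\<in>{vs ! n, vs ! n2}. A $ i $ l * X $ l $ (vs ! n1))"
    proof (rule sum.mono_neutral_right)
      show "\<forall>l\<in>UNIV - {vs ! n, vs ! n2}. A $ i $ l * X $ l $ (vs ! n1) = 0"
      proof (intro ballI, rule ccontr)
        fix l assume l: "l \<in> UNIV - {vs ! n, vs ! n2}" and "A $ i $ l * X $ l $ (vs ! n1) \<noteq> 0"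
        then have nz: "A $ i $ l \<noteq> 0" "X $ l $ (vs ! n1) \<noteq> 0" by auto
        have n1N: "vs ! n1 \<in> N" using CN inC lt by blast
        then have "l \<noteq> i" using nz(2) X_edge by (auto simp: N_def nbhd_def)
        then have lN: "l \<in> N" using nz(1) A_nonzero_iff[of i l] by (auto simp: N_def nbhd_def)
        have "l \<noteq> vs ! n1" using nz(2) X_diag by auto
        \<comment> \<open>A nonzero off-diagonal entry of \<open>X\<close> can sit only at a white
          non-edge; hence \<open>l\<close> lies in the component and is a cycle neighbor of
          \<open>vs ! n1\<close>.\<close>
        then have "{vs ! n1, l} \<in> W"
          using nz(2) X_edge blue by (auto simp: W_def white_nonedges_def complement_def insert_commute)
        moreover from this have "l \<in> C" using C_closed inC lt lN by blast
        ultimately have "{vs ! n1, l} \<in> induced_edges W C"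
          using inC lt by (auto simp: induced_edges_def)
        then obtain p where p: "p < m" "{vs ! n1, l} = {vs ! p, vs ! (Suc p mod m)}"
          unfolding edges m_def by blast
        then consider "vs ! n1 = vs ! p" "l = vs ! (Suc p mod m)"
          | "vs ! n1 = vs ! (Suc p mod m)" "l = vs ! p"
          by (auto simp: doubleton_eq_iff)
        then show False
        proof cases
          case 1
          then have "n1 = p" using vs_inj lt p by blast
          then show False using 1 l by (simp add: n2_def)
        next
          case 2
          then have "n1 = Suc p mod m" using vs_inj lt p by auto
          then have "Suc p mod m = Suc n mod m" by (simp only: n1_def)
          then have "p = n" by (rule mod_Suc_cancel[OF _ p(1) n])
          then show False using 2 l by simp
        qed
      qed
    qed auto
    then show ?thesis using AX[of i "vs ! n1"] ne by simp
  qed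
  \<comment> \<open>Multiplying the row equation at a cycle vertex \<open>v\<close> by \<open>A $ i $ v\<close> makes the weights \<open>z\<close> of
    consecutive cycle edges differ by a sign, which is impossible around an odd cycle unless
    \<open>z = 0\<close>.\<close>
  define z where "z n = A $ i $ (vs ! n) * A $ i $ (vs ! (Suc n mod m))
    * X $ (vs ! n) $ (vs ! (Suc n mod m))" for n
  have "z n + z (Suc n mod m) = 0" if "n < m" for n
  proof -
    have "z n + z (Suc n mod m) = A $ i $ (vs ! (Suc n mod m)) * 0"
      unfolding row[OF that refl refl, symmetric] z_def
      using X_sym[of "vs ! (Suc n mod m)" "vs ! (Suc (Suc n mod m) mod m)"]
      by (simp add: algebra_simps)
    then show ?thesis by simp
  qed
  then have z0: "z n = 0" if "n < m" for n
    using alternating_odd_cycle_zero[OF m(2)] that by blast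
  have "X $ (vs ! n) $ (vs ! (Suc n mod m)) = 0" if "n < m" for n
  proof -
    have "Suc n mod m < m" using m by simp
    then show ?thesis using z0[OF that] A_C inC that by (auto simp: z_def)
  qed
  moreover obtain n where "n < m" "{j, k} = {vs ! n, vs ! (Suc n mod m)}"
    using jk edges unfolding W_def m_def by blast
  ultimately show ?thesis using X_sym by (auto simp: doubleton_eq_iff)
qed

lemma vc_step_zero:
  assumes "vc_step G B BE BE'"
    and "\<And>j k. {j, k} \<in> BE \<Longrightarrow> X $ j $ k = 0"
    and "{j, k} \<in> BE'"
  shows "X $ j $ k = 0"
  using assms(1)
proof cases
  case (triple k' i' j')
  have "X $ j' $ k' = 0" by (rule forcing_triple_zero[OF assms(2) triple(2)])
  then have "X $ k' $ j' = 0" using X_sym by metis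
  with \<open>X $ j' $ k' = 0\<close> show ?thesis
    using triple(1) assms(2,3) by (auto simp: doubleton_eq_iff)
next
  case (odd_cycle i' C)
  then show ?thesis
    using white_odd_cycle_zero[OF assms(2)] assms(2,3) by blast
qed

text \<open>The invariant is that \<open>X\<close> vanishes at every blue non-edge. It holds at the
  start since each such non-edge meets \<open>B\<close> and \<open>X\<close> is symmetric, and every
  step keeps it.\<close>

lemma vc_forcing_zero:
  assumes "vc_forcing_set G B" and B: "\<And>b k. b \<in> B \<Longrightarrow> X $ b $ k = 0"
  shows "X = 0"
proof -
  have "(vc_step G B)\<^sup>*\<^sup>* (nonedge_closure G B) (complement G)"
    using assms(1) by (simp add: vc_forcing_set_def)
  then have compl: "\<forall>j k. {j, k} \<in> complement G \<longrightarrow> X $ j $ k = 0"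
  proof induction
    case base
    show ?case
    proof (intro allI impI)
      fix j k assume "{j, k} \<in> nonedge_closure G B"
      then have "j \<in> B \<or> k \<in> B" by (auto simp: nonedge_closure_def)
      then show "X $ j $ k = 0" using B X_sym by metis
    qed
  next
    case (step BE BE')
    then show ?case using vc_step_zero by blast
  qed
  have "X $ j $ k = 0" for j k
    using compl X_diag X_edge by (cases "j = k"; cases "{j, k} \<in> G") (auto simp: complement_def)
  then show ?thesis by (simp add: vec_eq_iff)
qed

end

section \<open>The SAP for the shifted matrix and the inequality\<close>

lemma SAP_if_kernel_vanishes:
  fixes G :: "'v::finite edges"
  assumes "simple_graph G" "A \<in> graph_matrices G" "vc_forcing_set G B"
    and ker: "\<And>x b. A *v x = 0 \<Longrightarrow> b \<in> B \<Longrightarrow> x $ b = 0"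
  shows "SAP A"
  unfolding SAP_def
proof (intro allI impI, elim conjE)
  fix X :: "real ^ 'v ^ 'v"
  assume X: "transpose X = X" "A * X = 0" "mat 1 * X = 0" "A ** X = 0"
  have sym: "X $ j $ k = X $ k $ j" for j k
    using arg_cong[OF X(1), of "\<lambda>Y. Y $ k $ j"] by (simp add: transpose_def)
  have diag: "X $ k $ k = 0" for k
    using arg_cong[OF X(3), of "\<lambda>Y. Y $ k $ k"] by (simp add: mat_def)
  have AX: "(\<Sum>l\<in>UNIV. A $ i $ l * X $ l $ k) = 0" for i k
    using arg_cong[OF X(4), of "\<lambda>Y. Y $ i $ k"] by (simp add: matrix_matrix_mult_def)
  have edge: "X $ j $ k = 0" if "{j, k} \<in> G" for j k
  proof -
    have "j \<noteq> k" using that assms(1) by (auto simp: simple_graph_def)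
    then have "A $ j $ k \<noteq> 0" using that assms(2) by (simp add: graph_matrices_def)
    then show ?thesis using arg_cong[OF X(2), of "\<lambda>Y. Y $ j $ k"] by simp
  qed
  interpret SAP_kernel G A X
    by unfold_locales (use assms sym diag edge AX in auto)
  have "A *v column k X = 0" for k
    by (simp add: vec_eq_iff matrix_vector_mult_def column_def AX)
  from ker[OF this] have "X $ b $ k = 0" if "b \<in> B" for b k
    using that by (simp add: column_def)
  then show "X = 0" using vc_forcing_zero assms(3) by blast
qed

theorem theorem3p2:
  fixes G :: "'v::finite edges"
  assumes "simple_graph G"
  shows "int (max_nullity G) - int (Z_vc G) \<le> int (xi G)"
proof -
  obtain A where A: "A \<in> graph_matrices G" "max_nullity G = nullity A"
    using Max_in[OF max_nullity_wf, of G] unfolding max_nullity_def by blast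
  obtain B where B: "vc_forcing_set G B" "Z_vc G = card B"
    using Min_in[OF Z_vc_wf, of G] unfolding Z_vc_def by blast
  have symA: "transpose A = A" using A by (simp add: graph_matrices_def)
  obtain t where t: "\<And>x b. A *v x + t *\<^sub>R (\<chi> i. if i \<in> B then x $ i else 0) = 0 \<Longrightarrow>
      b \<in> B \<Longrightarrow> x $ b = 0"
    using diagonal_shift_kernel_vanishes[OF symA] by blast
  define D :: "real ^ 'v ^ 'v" where "D = (\<chi> i j. if i = j \<and> i \<in> B then t else 0)"
  have Dx: "D *v x = t *\<^sub>R (\<chi> i. if i \<in> B then x $ i else 0)" for x
    by (auto simp: vec_eq_iff D_def matrix_vector_mult_def if_distrib[of "\<lambda>u. u * _"] cong: if_cong)
  have AD: "(A + D) *v x = A *v x + t *\<^sub>R (\<chi> i. if i \<in> B then x $ i else 0)" for x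
    by (simp add: matrix_vector_mult_add_rdistrib Dx)
  \<comment> \<open>\<open>D\<close> is diagonal, so the shift keeps the off-diagonal
    pattern.\<close>
  have mem: "A + D \<in> graph_matrices G"
    using A(1) by (auto simp: graph_matrices_def D_def transpose_def vec_eq_iff)
  have "SAP (A + D)"
    using SAP_if_kernel_vanishes[OF assms mem B(1)] t unfolding AD by blast
  with mem have "nullity (A + D) \<le> xi G"
    unfolding xi_def by (intro Max_ge xi_wf) blast
  moreover have "nullity A \<le> nullity (A + D) + card B"
  proof -
    have "subspace {x. A *v x = 0}"
      by (auto simp: subspace_def matrix_vector_right_distrib scalar_mult_eq_scaleR[symmetric] vec.scale)
    from dim_Int_vanishing_ge[OF this, of B]
    have "nullity A \<le> dim ({x. A *v x = 0} \<inter> {x. \<forall>b\<in>B. x $ b = 0}) + card B"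
      by (simp add: nullity_def)
    \<comment> \<open>On vectors that vanish on \<open>B\<close> the matrix \<open>D\<close> acts as
      zero.\<close>
    moreover have "{x. A *v x = 0} \<inter> {x. \<forall>b\<in>B. x $ b = 0} \<subseteq> {x. (A + D) *v x = 0}"
      unfolding AD by (auto simp: vec_eq_iff)
    then have "dim ({x. A *v x = 0} \<inter> {x. \<forall>b\<in>B. x $ b = 0}) \<le> nullity (A + D)"
      unfolding nullity_def by (rule dim_subset)
    ultimately show ?thesis by linarith
  qed
  ultimately show ?thesis using A(2) B(2) by linarith
qed

end
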